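(* Let $n\ge 0$ and let $u\in[2]^n$, i.e. $u$ is a word of length $n$ whose letters all lie in $\{1,2\}$. Then $u$ is strongly stable: $C(u^k)=C(u)$ for every integer $k\ge 1$.
   Context: Words are finite sequences of positive integers; juxtaposition denotes concatenation, and $u^k$ denotes $u$ concatenated with itself $k$ times. For a word $w$, $P(w)$ is its insertion tableau under the Robinson–Schensted–Knuth (row-insertion) correspondence. The centralizer of a word $u$ in the plactic monoid is $C(u)=\{w \text{ a word over the positive integers} : P(uw)=P(wu)\}$. A word $u$ is called strongly stable if $C(u^k)=C(u)$ for all $k\ge1$. *)

theory Defs imports Main begin

definition words :: "nat set \<Rightarrow> nat list set" where
  "words A = {w. set w \<subseteq> A}"

abbreviation positive_words :: "nat list set" where
  "positive_words \<equiv> words {1..}"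

definition words_of_length :: "nat \<Rightarrow> nat \<Rightarrow> nat list set" where
  "words_of_length m n = {w \<in> words {1..m}. length w = n}"

definition word_power :: "nat list \<Rightarrow> nat \<Rightarrow> nat list" where
  "word_power u k = concat (replicate k u)"

text \<open>
  Row insertion into a single weakly increasing row: the inserted letter replaces the leftmost
  entry strictly larger than it, and that entry is returned as the bumped letter; if there is no
  such entry, the letter is appended and nothing is bumped.
\<close>

fun row_insert :: "nat \<Rightarrow> nat list \<Rightarrow> nat list \<times> nat option" where
  "row_insert x [] = ([x], None)"
| "row_insert x (y # ys) =
     (if x < y then (x # ys, Some y)
      else (case row_insert x ys of (zs, b) \<Rightarrow> (y # zs, b)))"

text \<open>A tableau is the list of its rows, the first (longest) row coming first.\<close>

fun tableau_insert :: "nat \<Rightarrow> nat list list \<Rightarrow> nat list list" where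
  "tableau_insert x [] = [[x]]"
| "tableau_insert x (r # rs) =
     (case row_insert x r of
        (r', None) \<Rightarrow> r' # rs
      | (r', Some y) \<Rightarrow> r' # tableau_insert y rs)"

text \<open>The letters are inserted from left to right, starting from the empty tableau.\<close>

definition insertion_tableau :: "nat list \<Rightarrow> nat list list" where
  "insertion_tableau w = fold tableau_insert w []"

definition centralizer :: "nat list \<Rightarrow> nat list set" where
  "centralizer u =
     {w \<in> positive_words. insertion_tableau (u @ w) = insertion_tableau (w @ u)}"

definition strongly_stable :: "nat list \<Rightarrow> bool" where
  "strongly_stable u \<longleftrightarrow> (\<forall>k\<ge>1. centralizer (word_power u k) = centralizer u)"

end

theory Submission imports Defs "HOL-Library.Multiset" begin

text \<open>
  Left multiplication by a word over \<open>{1, 2}\<close> is column insertion; it changes only the first two rows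
  and commutes with row insertion, which reduces commutation with \<open>u\<close> to a computation on the
  tableau \<open>T = P(w)\<close>. Row insertion of 1 and 2 can only remove letters above 2 from the first row, while
  column insertion can only add them. Hence, when \<open>u\<close> contains a 2, commutation with \<open>u\<^sup>k\<close> forces
  the first row of \<open>T\<close> to lie in \<open>{1, 2}\<close>. If the second row still contains a letter above 2,
  the same count there shows that nothing is bumped, so \<open>u\<close> is a power of the letter 2 and \<open>w\<close> commutes with 2.
  Otherwise everything happens in the plactic monoid of rank two, whose elements are
  \<open>1\<^sup>c 2\<^sup>d (21)\<^sup>e\<close> with \<open>21\<close> central; there, commutation of \<open>(c, d, e)\<close> with \<open>(a, b, f)\<close> means
  \<open>min b c = min a d\<close>, a condition that is the same for \<open>u\<close> and \<open>u\<^sup>k\<close>.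
  If \<open>u\<close> is a power of the letter 1, comparing the lengths of the first rows shows that \<open>w\<close> commutes with 1.
\<close>

section \<open>Row insertion into a single row\<close>

lemma row_insert_None: "row_insert z r = (r', None) \<Longrightarrow> r' = r @ [z] \<and> (\<forall>c\<in>set r. c \<le> z)"
  by (induction r arbitrary: r') (auto split: if_splits prod.splits)

lemma row_insert_Some:
  assumes "row_insert z r = (r', Some b)"
  shows "add_mset b (mset r') = add_mset z (mset r)" and "length r' = length r" and "z < b"
  using assms by (induction r arbitrary: r') (auto split: if_splits prod.splits)

lemma row_insert_Some_le:
  assumes "row_insert z r = (r', Some b)" "sorted r" "c \<in> set r" "z < c"
  shows "b \<le> c"
  using assms by (induction r arbitrary: r') (auto split: if_splits prod.splits)

lemma row_insert_Some_mem: "row_insert z r = (r', Some b) \<Longrightarrow> b \<in> set r"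
  by (induction r arbitrary: r') (auto split: if_splits prod.splits)

lemma row_insert_Some_hd: "row_insert z r = (r', Some b) \<Longrightarrow> \<exists>x s. r' = x # s \<and> x \<le> z"
  by (induction r arbitrary: r') (auto split: if_splits prod.splits)

lemma set_row_insert: "row_insert z r = (r', out) \<Longrightarrow> set r' \<subseteq> insert z (set r)"
  by (induction r arbitrary: r') (auto split: if_splits prod.splits)

lemma sorted_row_insert: "row_insert z r = (r', out) \<Longrightarrow> sorted r \<Longrightarrow> sorted r'"
proof (induction r arbitrary: r')
  case (Cons x r)
  then show ?case
    by (fastforce split: if_splits prod.splits dest: set_row_insert)
qed auto

lemma row_insert_append:
  assumes "\<forall>c\<in>set r. c \<le> z" shows "row_insert z r = (r @ [z], None)"
  using assms by (induction r) auto

section \<open>Two rows: column insertion commutes with row insertion\<close>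

fun column_strict :: "nat list \<Rightarrow> nat list \<Rightarrow> bool" where
  "column_strict r [] = True"
| "column_strict [] (y # ys) = False"
| "column_strict (x # xs) (y # ys) = (x < y \<and> column_strict xs ys)"

fun insert2 :: "nat \<Rightarrow> nat list \<times> nat list \<Rightarrow> (nat list \<times> nat list) \<times> nat option" where
  "insert2 z (r, s) =
     (case row_insert z r of
        (r', None) \<Rightarrow> ((r', s), None)
      | (r', Some b) \<Rightarrow> (case row_insert b s of (s', out) \<Rightarrow> ((r', s'), out)))"

text \<open>
  Column insertion of \<open>a\<close> into a two-row tableau, under the assumption that \<open>a\<close> is at most every
  entry of the second row, so that nothing reaches the third row.
\<close>

fun column_insert2 :: "nat \<Rightarrow> nat list \<Rightarrow> nat list \<Rightarrow> nat list \<times> nat list" where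
  "column_insert2 a [] s = ([a], s)"
| "column_insert2 a (x # r) s =
     (if a \<le> x then (a # x # r, s)
      else (case s of
        [] \<Rightarrow> (x # r, [a])
      | y # ys \<Rightarrow> (case column_insert2 y r ys of (r', s') \<Rightarrow> (x # r', a # s'))))"

lemma mset_column_insert2:
  "column_insert2 a r s = (r', s') \<Longrightarrow> mset r' + mset s' = add_mset a (mset r + mset s)"
  by (induction a r s arbitrary: r' s' rule: column_insert2.induct)
    (auto split: if_splits list.splits prod.splits)

lemma column_strict_row_insert:
  "row_insert z r = (r', out) \<Longrightarrow> column_strict r s \<Longrightarrow> column_strict r' s"
  by (induction r s arbitrary: r' rule: column_strict.induct) (auto split: if_splits prod.splits)

text \<open>While \<open>z\<close> passes an entry \<open>x\<close>, \<open>x \<le> z < b\<close>,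
  so \<open>b\<close> may land beneath \<open>x\<close>. The entry that \<open>z\<close> bumps is
  smaller than any entry beneath it, so it lands there at the latest.\<close>

lemma column_strict_row_insert_Some:
  assumes "row_insert z r = (r', Some b)" "row_insert b s = (s', out)" "column_strict r s"
  shows "column_strict r' s'"
  using assms
proof (induction r s arbitrary: r' s' rule: column_strict.induct)
  case (1 r)
  then show ?case using row_insert_Some_hd row_insert_Some(3) by fastforce
next
  case (3 x xs y ys)
  show ?case
  proof (cases "z < x")
    case True
    then show ?thesis using 3 by auto
  next
    case False
    then obtain xs' where xs': "row_insert z xs = (xs', Some b)" "r' = x # xs'"
      using 3 by (auto split: prod.splits)
    then have "x < b" using False row_insert_Some(3) by fastforce
    then show ?thesis
      using 3 xs' column_strict_row_insert[OF xs'(1)] by (auto split: if_splits prod.splits)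
  qed
qed auto

text \<open>
  If the bumped letter is smaller than the letter that is inserted by columns, the two operations
  do not interact in the second row.
\<close>

lemma column_insert2_row_insert_small:
  assumes "row_insert z r = (r', Some b)" "b < y" "sorted r" "sorted (y # ys)"
    "column_insert2 y r ys = (p, q)"
  shows "\<exists>p'. row_insert z p = (p', Some b) \<and> column_insert2 y r' ys = (p', q)"
  using assms
proof (induction r arbitrary: r' y ys p q)
  case (Cons x r)
  have "b \<in> set (x # r)" using Cons.prems(1) by (rule row_insert_Some_mem)
  then have xy: "x < y" using Cons.prems by auto
  show ?case
  proof (cases "z < x")
    case True
    then show ?thesis using Cons.prems xy by (auto split: list.splits prod.splits)
  next
    case False
    then obtain t where t: "row_insert z r = (t, Some b)" "r' = x # t"
      using Cons.prems by (auto split: prod.splits)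
    show ?thesis
    proof (cases ys)
      case Nil
      then show ?thesis using Cons.prems xy False t by auto
    next
      case (Cons y2 yt)
      obtain p2 q2 where pq: "column_insert2 y2 r yt = (p2, q2)" by fastforce
      obtain p' where "row_insert z p2 = (p', Some b)" "column_insert2 y2 t yt = (p', q2)"
        using Cons.IH[OF t(1) _ _ _ pq] Cons.prems Cons by auto
      then show ?thesis using Cons.prems xy False t pq Cons by auto
    qed
  qed
qed auto

text \<open>The hypothesis on \<open>z\<close> says that \<open>z\<close> can bump nothing below
  \<open>a\<close>. It is automatic for \<open>a \<le> 2\<close> and \<open>1 \<le> z\<close>, and
  the next column inherits it with the displaced \<open>y\<close> for \<open>a\<close>, unless the
  bumped letter is below \<open>y\<close>; that case is the preceding lemma. Equal
  \<open>out\<close> means that the third row receives the same letter.\<close>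

lemma insert2_column_insert2:
  assumes "sorted r" "sorted (a # s)" "column_strict r s" "\<forall>c\<in>set r. z < c \<longrightarrow> a \<le> c"
    "insert2 z (r, s) = ((r', s'), out)"
  shows "insert2 z (column_insert2 a r s) = (column_insert2 a r' s', out)"
  using assms
proof (induction r arbitrary: a s r' s' out)
  case Nil
  then show ?case by (cases s) auto
next
  case (Cons x r)
  show ?case
  proof (cases "a \<le> x")
    case ax: True
    show ?thesis
    proof (cases "z < a")
      \<comment> \<open>In either order the first row starts with \<open>z\<close>, \<open>x\<close>
        and the second with \<open>a\<close>: \<open>z\<close> bumps \<open>a\<close>, or
        \<open>z\<close> bumps \<open>x\<close> and \<open>a\<close> then sends \<open>x\<close>
        back up.\<close>
      case True
      then show ?thesis using Cons.prems ax
        by (cases s; cases r) (auto split: prod.splits)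
    next
      case False
      show ?thesis
      proof (cases "row_insert z (x # r)")
        case (Pair t o1)
        \<comment> \<open>The head of the row stays at least \<open>a\<close>, so column insertion
          of \<open>a\<close> puts it in front in both orders.\<close>
        then have "\<exists>x' t'. t = x' # t' \<and> a \<le> x'" using False ax by (auto split: if_splits prod.splits)
        then show ?thesis using Cons.prems ax False Pair
          by (auto simp del: row_insert.simps(2) simp: row_insert.simps(2)[of _ a] split: option.splits prod.splits)
      qed
    qed
  next
    case ax: False
    then have zx: "\<not> z < x" using Cons.prems by auto
    obtain t o1 where t: "row_insert z r = (t, o1)" by fastforce
    show ?thesis
    proof (cases s)
      case Nil
      show ?thesis
      proof (cases o1)
        case None
        then show ?thesis using Cons.prems ax zx t Nil by auto
      next
        case (Some b)
        then have "a \<le> b" using Cons.prems t row_insert_Some_mem row_insert_Some(3) by fastforce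
        moreover obtain x' t' where "t = x' # t'" "x' \<le> z" using row_insert_Some_hd t Some by blast
        ultimately show ?thesis using Cons.prems ax zx t Nil Some row_insert_Some(3)[OF t[unfolded Some]]
          by auto
      qed
    next
      case (Cons y ys)
      obtain p q where pq: "column_insert2 y r ys = (p, q)" by fastforce
      show ?thesis
      proof (cases "\<exists>b. o1 = Some b \<and> b < y")
        case True
        then obtain b where b: "o1 = Some b" "b < y" by blast
        obtain p' where p': "row_insert z p = (p', Some b)" "column_insert2 y t ys = (p', q)"
          using column_insert2_row_insert_small[OF t[unfolded b] b(2) _ _ pq] Cons.prems Cons by auto
        have ab: "a \<le> b" using Cons.prems t b row_insert_Some_mem row_insert_Some(3) by fastforce
        obtain x' t' where x': "t = x' # t'" "x' \<le> z" using row_insert_Some_hd t b by blast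
        have zb: "z < b" using row_insert_Some(3) t b by blast
        have out: "out = Some y" "r' = x # t" "s' = b # ys"
          using Cons.prems zx t b Cons by auto
        \<comment> \<open>The head of \<open>t\<close> is below both \<open>b\<close> and
          \<open>y\<close>, so column insertion of either takes the same path; only the head left in
          the second row differs.\<close>
        obtain q' where "q = y # q'" "column_insert2 b t ys = (p', b # q')"
          using p'(2) x' zb b(2) by (auto split: list.splits prod.splits)
        then show ?thesis
          using zx ax Cons pq p' ab zb b out by auto
      next
        case False
        have C: "\<forall>c\<in>set r. z < c \<longrightarrow> y \<le> c"
        proof (intro ballI impI)
          fix c assume c: "c \<in> set r" "z < c"
          show "y \<le> c"
          proof (cases o1)
            case None
            then show ?thesis using t row_insert_None c by fastforce
          next
            case (Some b)
            then show ?thesis using t row_insert_Some_le[of z r t b c] c Cons.prems False by auto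
          qed
        qed
        obtain ys' where ys': "insert2 z (r, ys) = ((t, ys'), out)" "r' = x # t" "s' = y # ys'"
          using Cons.prems zx t Cons False by (auto split: option.splits prod.splits)
        have IH: "insert2 z (p, q) = (column_insert2 y t ys', out)"
          using Cons.IH[OF _ _ _ C ys'(1)] Cons.prems Cons pq by auto
        \<comment> \<open>The letter bumped out of \<open>p\<close> must pass the \<open>a\<close>
          that now heads the second row.\<close>
        have "a \<le> b" if "row_insert z p = (p', Some b)" for p' b
        proof -
          have "set p \<subseteq> set r \<union> set (y # ys)"
            using arg_cong[OF mset_column_insert2[OF pq], of set_mset] by auto
          then show ?thesis
            using row_insert_Some_mem[OF that] row_insert_Some(3)[OF that] C Cons.prems Cons by fastforce
        qed
        then show ?thesis
          using IH zx ax Cons pq ys' by (auto split: option.splits prod.splits)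
      qed
    qed
  qed
qed

section \<open>Splitting off two rows; left multiplication by words over {1, 2}\<close>

type_synonym split_tableau = "(nat list \<times> nat list) \<times> nat list list"

text \<open>Absent rows count as empty, so insertion needs no case for them. Nothing is lost, since
  insertion tableaux have no empty rows.\<close>

fun split_rows :: "nat list list \<Rightarrow> split_tableau" where
  "split_rows [] = (([], []), [])"
| "split_rows [r] = ((r, []), [])"
| "split_rows (r # s # rs) = ((r, s), rs)"

fun insert_rows :: "nat \<Rightarrow> split_tableau \<Rightarrow> split_tableau" where
  "insert_rows z (t, rs) =
     (case insert2 z t of
        (t', None) \<Rightarrow> (t', rs)
      | (t', Some b) \<Rightarrow> (t', tableau_insert b rs))"

fun left_insert :: "nat \<Rightarrow> split_tableau \<Rightarrow> split_tableau" where
  "left_insert a ((r, s), rs) = (column_insert2 a r s, rs)"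

fun valid :: "split_tableau \<Rightarrow> bool" where
  "valid ((r, s), rs) \<longleftrightarrow> sorted r \<and> sorted s \<and> column_strict r s \<and> (\<forall>c\<in>set r. 1 \<le> c)"

definition rows :: "nat list \<Rightarrow> split_tableau" where
  "rows w = fold insert_rows w (([], []), [])"

lemma split_rows_tableau_insert: "split_rows (tableau_insert x T) = insert_rows x (split_rows T)"
  by (cases T rule: split_rows.cases) (auto split: option.splits prod.splits)

lemma rows_eq_split: "rows w = split_rows (insertion_tableau w)"
  unfolding rows_def insertion_tableau_def
  by (induction w rule: rev_induct) (auto simp: split_rows_tableau_insert)

lemma Nil_notin_tableau_insert: "[] \<notin> set T \<Longrightarrow> [] \<notin> set (tableau_insert x T)"
proof (induction T arbitrary: x)
  case (Cons r T)
  have "row_insert x r \<noteq> ([], out)" for out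
    by (cases r) (auto split: prod.splits)
  then show ?case using Cons by (auto split: option.splits prod.splits) (metis+)
qed auto

lemma Nil_notin_insertion_tableau: "[] \<notin> set (insertion_tableau w)"
  unfolding insertion_tableau_def
  by (induction w rule: rev_induct) (auto simp: Nil_notin_tableau_insert)

lemma split_rows_inject:
  "[] \<notin> set S \<Longrightarrow> [] \<notin> set T \<Longrightarrow> split_rows S = split_rows T \<longleftrightarrow> S = T"
  by (cases S rule: split_rows.cases; cases T rule: split_rows.cases) auto

lemma insertion_tableau_eq_iff: "insertion_tableau v = insertion_tableau w \<longleftrightarrow> rows v = rows w"
  by (simp add: rows_eq_split split_rows_inject Nil_notin_insertion_tableau)

lemma rows_append: "rows (v @ w) = fold insert_rows w (rows v)"
  by (simp add: rows_def)

lemma valid_insert_rows: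
  assumes "valid t" "1 \<le> z"
  shows "valid (insert_rows z t)"
proof -
  obtain r s rs where t: "t = ((r, s), rs)" by (metis prod.exhaust)
  show ?thesis
  proof (cases "row_insert z r")
    case (Pair r' out)
    have r': "sorted r'" "\<forall>c\<in>set r'. 1 \<le> c"
      using sorted_row_insert[OF Pair] set_row_insert[OF Pair] assms t by auto
    show ?thesis
    proof (cases out)
      case None
      then show ?thesis using r' assms t Pair column_strict_row_insert[OF Pair] by auto
    next
      case (Some b)
      obtain s' out' where s': "row_insert b s = (s', out')" by fastforce
      show ?thesis
        using r' assms t Pair Some s' sorted_row_insert[OF s']
          column_strict_row_insert_Some[OF _ s'] by (auto split: option.splits)
    qed
  qed
qed

lemma valid_rows: "w \<in> positive_words \<Longrightarrow> valid (rows w)"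
  by (induction w rule: rev_induct) (auto simp: rows_def words_def valid_insert_rows)

lemma column_strict_ge2:
  "column_strict r s \<Longrightarrow> \<forall>c\<in>set r. 1 \<le> c \<Longrightarrow> \<forall>c\<in>set s. 2 \<le> (c::nat)"
  by (induction r s rule: column_strict.induct) auto

text \<open>Entries of the second row are at least 2, hence at least \<open>a\<close>, so the
  two-row result applies and the rows below receive the same letter.\<close>

lemma insert_rows_left_insert:
  assumes "valid t" "a \<in> {1, 2}" "1 \<le> z"
  shows "insert_rows z (left_insert a t) = left_insert a (insert_rows z t)"
proof -
  obtain r s rs where t: "t = ((r, s), rs)" by (metis prod.exhaust)
  obtain r' s' out where i: "insert2 z (r, s) = ((r', s'), out)" by (metis prod.exhaust)
  have "\<forall>c\<in>set s. 2 \<le> c" using assms(1) t column_strict_ge2 by auto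
  then have "insert2 z (column_insert2 a r s) = (column_insert2 a r' s', out)"
    using assms t by (intro insert2_column_insert2[OF _ _ _ _ i]) auto
  then show ?thesis using t i by (auto split: option.splits simp del: insert2.simps)
qed

text \<open>True for the empty word, and preserved when a letter is inserted on the right, as the
  two insertions commute.\<close>

lemma rows_Cons:
  assumes "a \<in> {1, 2}" "w \<in> positive_words"
  shows "rows (a # w) = left_insert a (rows w)"
  using assms(2)
proof (induction w rule: rev_induct)
  case Nil
  show ?case by (simp add: rows_def)
next
  case (snoc z w)
  then have "w \<in> positive_words" "1 \<le> z" by (auto simp: words_def)
  then show ?case
    using snoc.IH insert_rows_left_insert[OF valid_rows assms(1)] rows_append[of "a # w" "[z]"]
    by (simp add: rows_append)
qed

lemma rows_append_left:
  assumes "set u \<subseteq> {1, 2}" "w \<in> positive_words"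
  shows "rows (u @ w) = foldr left_insert u (rows w)"
  using assms(1)
proof (induction u)
  case (Cons a u)
  then have "u @ w \<in> positive_words" using assms(2) by (auto simp: words_def)
  then show ?case using Cons rows_Cons[of a "u @ w"] by simp
qed simp

section \<open>Commutation with products, powers and words in the letter 1\<close>

abbreviation commute :: "nat list \<Rightarrow> nat list \<Rightarrow> bool" where
  "commute u w \<equiv> rows (u @ w) = rows (w @ u)"

text \<open>Exchanging \<open>v\<close> and \<open>w\<close> behind \<open>u\<close> needs that the
  result depends only on the tableau of what follows \<open>u\<close>;
  \<open>rows_append_left\<close> supplies this.\<close>

lemma commute_append:
  assumes "set u \<subseteq> {1, 2}" "set v \<subseteq> {1, 2}" "w \<in> positive_words" "commute u w" "commute v w"
  shows "commute (u @ v) w"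
proof -
  have pos: "v @ w \<in> positive_words" "w @ v \<in> positive_words"
    using assms by (auto simp: words_def)
  have "rows (u @ v @ w) = rows ((u @ w) @ v)"
    using rows_append_left[OF assms(1) pos(1)] rows_append_left[OF assms(1) pos(2)] assms(5) by simp
  also have "\<dots> = rows (w @ u @ v)"
    using rows_append[of "u @ w" v] rows_append[of "w @ u" v] assms(4) by simp
  finally show ?thesis by simp
qed

lemma word_power_simps [simp]:
  "word_power u 0 = []" "word_power u (Suc k) = u @ word_power u k"
  by (simp_all add: word_power_def)

lemma set_word_power: "set (word_power u k) \<subseteq> set u"
  by (induction k) auto

lemma commute_word_power:
  assumes "set u \<subseteq> {1, 2}" "w \<in> positive_words" "commute u w"
  shows "commute (word_power u k) w"
proof (induction k)
  case (Suc k)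
  have "set (word_power u k) \<subseteq> {1, 2}" using assms(1) set_word_power by blast
  then show ?case using commute_append assms Suc by simp
qed simp

lemma commute_constant:
  assumes "set u \<subseteq> {a}" "a \<in> {1, 2}" "w \<in> positive_words" "commute [a] w"
  shows "commute u w"
  using assms(1)
proof (induction u)
  case (Cons x u)
  have "set u \<subseteq> {1, 2}" using Cons.prems assms(2) by auto
  then show ?case using commute_append[of "[a]" u w] assms Cons by auto
qed simp

text \<open>Each 1 on the left lengthens the first row by one, and a letter on the right does so by
  at most one. So already the first 1 inserted on the right bumps nothing, and the first row
  consists of ones.\<close>

lemma commute_ones:
  assumes "set v = {1}" "w \<in> positive_words" "commute v w"
  shows "commute [1] w"
proof -
  define len :: "split_tableau \<Rightarrow> nat" where "len t = length (fst (fst t))" for t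
  have ub: "len (insert_rows z t) \<le> Suc (len t)" for z t
  proof -
    obtain r s rs where t: "t = ((r, s), rs)" by (metis prod.exhaust)
    then show ?thesis
      by (auto simp: len_def split: option.splits prod.splits dest!: row_insert_None row_insert_Some(2))
  qed
  have ubf: "len (fold insert_rows x t) \<le> len t + length x" for x t
  proof (induction x arbitrary: t)
    case (Cons z x)
    show ?case using Cons[of "insert_rows z t"] ub[of z t] order_trans by fastforce
  qed simp
  obtain r s rs where w: "rows w = ((r, s), rs)" by (metis prod.exhaust)
  have val: "valid ((r, s), rs)" using valid_rows[OF assms(2)] w by simp
  have left1: "left_insert 1 t = ((1 # fst (fst t), snd (fst t)), snd t)" if "valid t" for t
  proof -
    obtain r s rs where t: "t = ((r, s), rs)" by (metis prod.exhaust)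
    then show ?thesis using that by (cases r) auto
  qed
  have lenl: "len (rows (x @ w)) = length x + len (rows w)" if "set x \<subseteq> {1}" for x
    using that
  proof (induction x)
    case (Cons y x)
    then have "x @ w \<in> positive_words" using assms(2) by (auto simp: words_def)
    then show ?case
      using Cons rows_Cons[of 1 "x @ w"] left1[OF valid_rows] by (simp add: len_def)
  qed simp
  obtain v' where v: "v = 1 # v'" using assms(1) by (cases v) auto
  have "length v + len (rows w) = len (fold insert_rows v' (insert_rows 1 (rows w)))"
    using lenl[of v] assms(1,3) v rows_append[of w v] by simp
  also have "\<dots> \<le> len (insert_rows 1 (rows w)) + length v'" by (rule ubf)
  finally have len1: "len (insert_rows 1 (rows w)) \<ge> Suc (length r)"
    using v w by (simp add: len_def)
  have "snd (row_insert 1 r) = None"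
  proof (rule ccontr)
    assume "snd (row_insert 1 r) \<noteq> None"
    then obtain r' b where "row_insert 1 r = (r', Some b)" by (metis not_None_eq surjective_pairing)
    then show False using len1 w row_insert_Some(2)[of 1 r r' b] by (auto simp: len_def split: prod.splits option.splits)
  qed
  then have "\<forall>c\<in>set r. c \<le> 1" using row_insert_None[of 1 r] by (metis surjective_pairing)
  then have ones: "\<forall>c\<in>set r. c = 1" using val by (simp add: le_antisym)
  have "1 # r = r @ [1]" using ones by (induction r) auto
  then have "left_insert 1 (rows w) = insert_rows 1 (rows w)"
    using left1[of "rows w"] val w row_insert_append[of r 1] ones by simp
  then show ?thesis using rows_Cons[of 1 w] assms(2) rows_append[of w "[1]"] by simp
qed

section \<open>The plactic monoid of rank two\<close>

text \<open>The tableau of \<open>1^c 2^d (21)^e\<close>, followed by arbitrary rows. Since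
  \<open>c\<close> counts the ones with no 2 beneath, all parameters give column-strict
  rows.\<close>

definition conf :: "nat \<Rightarrow> nat \<Rightarrow> nat \<Rightarrow> nat list list \<Rightarrow> split_tableau" where
  "conf c d e rs = ((replicate (e + c) 1 @ replicate d 2, replicate e 2), rs)"

lemma conf_inject: "conf c d e rs = conf c' d' e' rs' \<Longrightarrow> e = e'"
  unfolding conf_def by (metis Pair_inject length_replicate)

lemma insert_rows_conf_2: "insert_rows 2 (conf c d e rs) = conf c (Suc d) e rs"
proof -
  have "row_insert 2 (replicate (e + c) 1 @ replicate d 2) =
      (replicate (e + c) 1 @ replicate (Suc d) 2, None)"
    by (subst row_insert_append) (auto simp: replicate_append_same)
  then show ?thesis by (simp add: conf_def)
qed

lemma row_insert_1: "row_insert 1 (replicate p 1 @ replicate (Suc d) 2) = (replicate (Suc p) 1 @ replicate d 2, Some 2)"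
  by (induction p) auto

text \<open>If there is a free 2, the last one and the new 1 form another central factor
  \<open>21\<close>.\<close>

lemma insert_rows_conf_1:
  "insert_rows 1 (conf c d e rs) = (if d = 0 then conf (Suc c) 0 e rs else conf c (d - 1) (Suc e) rs)"
proof (cases d)
  case 0
  then show ?thesis
    using row_insert_append[of "replicate (e + c) 1" 1] by (auto simp: conf_def replicate_append_same)
next
  case (Suc d')
  then show ?thesis
    using row_insert_1[of "e + c" d'] row_insert_append[of "replicate e 2" 2]
    by (auto simp: conf_def replicate_append_same)
qed

lemma left_insert_conf_1: "left_insert 1 (conf c d e rs) = conf (Suc c) d e rs"
  by (cases "e + c"; cases d) (auto simp: conf_def)

text \<open>A 2 is handed on through the \<open>e\<close> full columns unchanged, and settles in the
  next one: under a free 1 if there is one, else in front of the twos of the first row.\<close>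

lemma column_insert2_conf:
  "column_insert2 2 (replicate (e + c) 1 @ replicate d 2) (replicate e 2) =
    (if c = 0 then (replicate (e + c) 1 @ replicate (Suc d) 2, replicate e 2)
     else (replicate (e + c) 1 @ replicate d 2, replicate (Suc e) 2))"
proof (induction e)
  case 0
  then show ?case by (cases c; cases d) auto
next
  case (Suc e)
  then show ?case by auto
qed

lemma left_insert_conf_2:
  "left_insert 2 (conf c d e rs) = (if c = 0 then conf 0 (Suc d) e rs else conf (c - 1) d (Suc e) rs)"
  using column_insert2_conf[of e c d] by (cases c) (auto simp: conf_def)

text \<open>
  Right and left multiplication by \<open>1\<^sup>c 2\<^sup>d (21)\<^sup>e\<close>, to which \<open>u\<close> is plactically equivalent;
  the subtractions are truncated on purpose.
\<close>

definition normal_form :: "nat list \<Rightarrow> nat \<Rightarrow> nat \<Rightarrow> nat \<Rightarrow> bool" where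
  "normal_form u c d e \<longleftrightarrow> (\<forall>a b f rs.
     fold insert_rows u (conf a b f rs) = conf (a + (c - b)) (d + (b - c)) (f + e + min b c) rs \<and>
     foldr left_insert u (conf a b f rs) = conf (c + (a - d)) (b + (d - a)) (f + e + min a d) rs)"

lemma normal_form_Nil: "normal_form [] 0 0 0"
  by (simp add: normal_form_def)

text \<open>This is the product of the bicyclic monoid, with \<open>2^d\<close> cancelling against
  \<open>1^c'\<close>; the last exponent counts the cancelled pairs \<open>21\<close>.\<close>

lemma normal_form_append:
  assumes "normal_form u c d e" "normal_form v c' d' e'"
  shows "normal_form (u @ v) (c + (c' - d)) (d' + (d - c')) (e + e' + min d c')"
  unfolding normal_form_def
proof (intro allI conjI)
  fix a b f rs
  have eq: "conf x y z rs = conf x' y' z' rs" if "x = x'" "y = y'" "z = z'" for x y z x' y' z'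
    using that by simp
  show "fold insert_rows (u @ v) (conf a b f rs) =
      conf (a + (c + (c' - d) - b)) (d' + (d - c') + (b - (c + (c' - d))))
        (f + (e + e' + min d c') + min b (c + (c' - d))) rs"
    using assms unfolding normal_form_def by (auto intro!: eq simp: min_def)
  show "foldr left_insert (u @ v) (conf a b f rs) =
      conf (c + (c' - d) + (a - (d' + (d - c')))) (b + (d' + (d - c') - a))
        (f + (e + e' + min d c') + min a (d' + (d - c'))) rs"
    using assms unfolding normal_form_def by (auto intro!: eq simp: min_def)
qed

lemma normal_form_letter:
  "normal_form [1] 1 0 0" "normal_form [2] 0 1 0"
proof -
  have min_1: "min n (Suc 0) = (if n = 0 then 0 else 1)" for n by simp
  show "normal_form [1] 1 0 0"
    unfolding normal_form_def
    by (simp add: insert_rows_conf_1[simplified] left_insert_conf_1[simplified] min_1)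
  show "normal_form [2] 0 1 0"
    unfolding normal_form_def by (simp add: insert_rows_conf_2 left_insert_conf_2 min_1)
qed

lemma normal_form_exists: "set u \<subseteq> {1, 2} \<Longrightarrow> \<exists>c d e. normal_form u c d e"
proof (induction u)
  case (Cons x u)
  then show ?case
    using normal_form_append[of "[x]" _ _ _ u] normal_form_letter by fastforce
qed (use normal_form_Nil in blast)

text \<open>Each factor \<open>u\<close> adds the difference of \<open>c\<close> and
  \<open>d\<close> to the larger of the two and keeps the smaller. Only the order and the smaller
  value matter for commutation.\<close>

lemma normal_form_word_power:
  assumes "normal_form u c d e"
  shows "\<exists>c' d' e'. normal_form (word_power u (Suc k)) c' d' e' \<and>
    (d < c \<longrightarrow> d' = d \<and> d < c') \<and> (c < d \<longrightarrow> c' = c \<and> c < d') \<and> (c = d \<longrightarrow> c' = c \<and> d' = c)"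
proof (induction k)
  case 0
  then show ?case using assms by auto
next
  case (Suc k)
  then obtain c' d' e' where n: "normal_form (word_power u (Suc k)) c' d' e'"
    and ineq: "d < c \<longrightarrow> d' = d \<and> d < c'" "c < d \<longrightarrow> c' = c \<and> c < d'" "c = d \<longrightarrow> c' = c \<and> d' = c"
    by blast
  have "normal_form (word_power u (Suc (Suc k))) (c + (c' - d)) (d' + (d - c')) (e + e' + min d c')"
    using normal_form_append[OF assms n] by simp
  moreover have "(d < c \<longrightarrow> d' + (d - c') = d \<and> d < c + (c' - d)) \<and>
      (c < d \<longrightarrow> c + (c' - d) = c \<and> c < d' + (d - c')) \<and>
      (c = d \<longrightarrow> c + (c' - d) = c \<and> d' + (d - c') = c)"
    using ineq by auto
  ultimately show ?case by blast
qed

text \<open>The number of columns \<open>21\<close> gives the condition. It suffices, as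
  \<open>c + (a - d) = c + a - min a d\<close> and \<open>a + (c - b) = a + c - min b c\<close>, and
  likewise for the twos.\<close>

lemma normal_form_commute_iff:
  assumes "normal_form u c d e" "rows w = conf a b f rs" "set u \<subseteq> {1, 2}" "w \<in> positive_words"
  shows "commute u w \<longleftrightarrow> min b c = min a d"
proof
  assume eq: "commute u w"
  have "conf (c + (a - d)) (b + (d - a)) (f + e + min a d) rs =
      conf (a + (c - b)) (d + (b - c)) (f + e + min b c) rs"
    using eq assms(1,2) rows_append_left[OF assms(3,4)] rows_append[of w u]
    by (simp add: normal_form_def)
  then show "min b c = min a d" by (auto dest: conf_inject)
next
  assume *: "min b c = min a d"
  then have "c + (a - d) = a + (c - b)" "b + (d - a) = d + (b - c)" by linarith+
  then show "commute u w"
    using assms(1,2) * rows_append_left[OF assms(3,4)] rows_append[of w u]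
    by (simp add: normal_form_def)
qed

lemma commute_of_word_power_rank2:
  assumes "rows w = conf a b f rs" "set u \<subseteq> {1, 2}" "w \<in> positive_words"
    "commute (word_power u (Suc k)) w"
  shows "commute u w"
proof -
  obtain c d e where n: "normal_form u c d e" using normal_form_exists assms(2) by blast
  obtain c' d' e' where n': "normal_form (word_power u (Suc k)) c' d' e'"
    and ineq: "d < c \<longrightarrow> d' = d \<and> d < c'" "c < d \<longrightarrow> c' = c \<and> c < d'" "c = d \<longrightarrow> c' = c \<and> d' = c"
    using normal_form_word_power[OF n] by blast
  have "set (word_power u (Suc k)) \<subseteq> {1, 2}" using assms(2) set_word_power by blast
  then have "min b c' = min a d'" using normal_form_commute_iff[OF n' assms(1)] assms by blast
  \<comment> \<open>If \<open>d < c\<close>, both conditions say \<open>b = min a d\<close>, a value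
    below \<open>c\<close> and \<open>c'\<close>; the case \<open>c < d\<close> is
    symmetric.\<close>
  then have "min b c = min a d" using ineq by linarith
  then show ?thesis using normal_form_commute_iff[OF n assms(1)] assms by blast
qed


section \<open>Letters above 2 in the first two rows\<close>

definition big :: "nat list \<Rightarrow> nat" where
  "big r = size {#c \<in># mset r. 2 < c#}"

lemma big_eq_0_iff: "big r = 0 \<longleftrightarrow> (\<forall>c\<in>set r. c \<le> 2)"
  by (auto simp: big_def not_less)

lemma big_append: "big (r @ s) = big r + big s"
  by (simp add: big_def)

lemma big_row_insert_None: "row_insert z r = (r', None) \<Longrightarrow> z \<le> 2 \<Longrightarrow> big r' = big r"
  using row_insert_None by (fastforce simp: big_def)

lemma big_row_insert_Some:
  "row_insert z r = (r', Some b) \<Longrightarrow> z \<le> 2 \<Longrightarrow> big r = big r' + (if 2 < b then 1 else 0)"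
  using row_insert_Some(1)[of z r r' b, THEN arg_cong, of "\<lambda>M. size {#c \<in># M. 2 < c#}"]
  by (auto simp: big_def split: if_splits)

text \<open>The inserted letter is not above 2, and a 2 bumps the leftmost letter above 2 if there
  is one.\<close>

lemma big_insert_rows:
  assumes "z \<le> 2"
  shows "big (fst (fst (insert_rows z t))) \<le> big (fst (fst t))"
    and "z = 2 \<Longrightarrow> big (fst (fst t)) > 0 \<Longrightarrow> big (fst (fst (insert_rows z t))) < big (fst (fst t))"
proof -
  obtain r s rs where t: "t = ((r, s), rs)" by (metis prod.exhaust)
  obtain r' out where r': "row_insert z r = (r', out)" by fastforce
  have f: "fst (fst (insert_rows z t)) = r'"
    using t r' by (auto split: option.splits prod.splits)
  show "big (fst (fst (insert_rows z t))) \<le> big (fst (fst t))"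
    using f t r' assms big_row_insert_None big_row_insert_Some by (cases out) fastforce+
  show "big (fst (fst (insert_rows z t))) < big (fst (fst t))" if "z = 2" "big (fst (fst t)) > 0"
  proof (cases out)
    case None
    then have "big r = 0" using row_insert_None[of z r] r' that by (simp add: big_eq_0_iff)
    then show ?thesis using that t by simp
  next
    case (Some b)
    then have "2 < b" using row_insert_Some(3) r' that by blast
    then show ?thesis using f t r' Some assms big_row_insert_Some[of z r r' b] by simp
  qed
qed

lemma big_fold_insert_rows_le:
  assumes "\<forall>z\<in>set v. z \<le> 2"
  shows "big (fst (fst (fold insert_rows v t))) \<le> big (fst (fst t))"
  using assms
proof (induction v arbitrary: t)
  case (Cons z v)
  then show ?case using order_trans[OF Cons.IH[of "insert_rows z t"] big_insert_rows(1)[of z t]] by simp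
qed simp

lemma big_fold_insert_rows_less:
  assumes "2 \<in> set v" "big (fst (fst t)) > 0" "\<forall>z\<in>set v. z \<le> 2"
  shows "big (fst (fst (fold insert_rows v t))) < big (fst (fst t))"
  using assms
proof (induction v arbitrary: t)
  case (Cons z v)
  show ?case
  \<comment> \<open>Ones before the first 2 may already have bumped all letters above 2; then the
    count has dropped to 0 from a positive value.\<close>
  proof (cases "z = 2 \<or> big (fst (fst (insert_rows z t))) = 0")
    case True
    then have "big (fst (fst (insert_rows z t))) < big (fst (fst t))"
      using big_insert_rows(2)[of z t] Cons.prems by auto
    then show ?thesis
      using big_fold_insert_rows_le[of v "insert_rows z t"] Cons.prems by simp
  next
    case False
    then show ?thesis
      using Cons.IH[of "insert_rows z t"] Cons.prems big_insert_rows(1)[of z t] by auto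
  qed
qed simp

text \<open>Only second-row entries are displaced, and each one is replaced by the letter that
  displaces it.\<close>

lemma column_insert2_mono:
  "column_insert2 a r s = (r', s') \<Longrightarrow> mset r \<subseteq># mset r' \<and> length s \<le> length s'"
  by (induction a r s arbitrary: r' s' rule: column_insert2.induct)
    (auto split: if_splits list.splits prod.splits)

lemma foldr_left_insert_mono:
  assumes "foldr left_insert v ((r, s), rs) = ((r', s'), rs')"
  shows "mset r \<subseteq># mset r' \<and> length s \<le> length s' \<and> rs' = rs \<and>
    mset r' + mset s' = mset v + mset r + mset s"
  using assms
proof (induction v arbitrary: r' s' rs')
  case (Cons a v)
  obtain p q ps where t: "foldr left_insert v ((r, s), rs) = ((p, q), ps)" by (metis prod.exhaust)
  then have c: "column_insert2 a p q = (r', s')" "rs' = ps" using Cons.prems by auto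
  show ?case
    using Cons.IH[OF t] column_insert2_mono[OF c(1)] mset_column_insert2[OF c(1)] c(2)
    by (auto intro: subset_mset.order_trans)
qed auto

text \<open>All first-row entries are below \<open>a\<close>, hence below the second row, so the
  carried letter moves on until a row ends: it joins the second row if that is shorter, else the
  last carried letter is appended to the first.\<close>

lemma fst_column_insert2:
  assumes "\<forall>c\<in>set r. c < a" "sorted (a # s)" "column_strict r s"
  shows "fst (column_insert2 a r s) \<in> {r, r @ [last (a # s)]}"
  using assms
proof (induction a r s rule: column_insert2.induct)
  case (1 a s)
  then show ?case by (cases s) auto
next
  case (2 a x r s)
  show ?case
  proof (cases s)
    case (Cons y ys)
    then have "\<forall>c\<in>set r. c < y" using 2(2,3) by fastforce
    then have "fst (column_insert2 y r ys) \<in> {r, r @ [last (y # ys)]}"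
      using 2 Cons by (intro 2(1)[OF _ Cons]) auto
    then show ?thesis using 2 Cons by (auto split: prod.splits)
  qed (use 2 in auto)
qed

text \<open>
  When the second row contains a letter above 2, every 2 bumped out of the first row expels one such
  letter from the second row.
\<close>

lemma fold_insert_rows_no_bump:
  assumes "set v \<subseteq> {1, 2}" "set r \<subseteq> {1, 2}"
    "fold insert_rows v ((r, s), rs) = ((r', s'), rs')"
  shows "big s' \<le> big s \<and>
    (big s > 0 \<and> big s' = big s \<longrightarrow> r' = r @ v \<and> s' = s \<and> rs' = rs) \<and> set r' \<subseteq> {1, 2}"
  using assms
proof (induction v arbitrary: r s rs)
  case (Cons z v)
  obtain r1 out where r1: "row_insert z r = (r1, out)" by fastforce
  have r1set: "set r1 \<subseteq> {1, 2}" using set_row_insert[OF r1] Cons.prems by auto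
  show ?case
  proof (cases out)
    case None
    then have "r1 = r @ [z]" using row_insert_None r1 by blast
    then show ?thesis using Cons.IH[of "r @ [z]" s rs] Cons.prems r1 r1set None by auto
  next
    case (Some b)
    have b: "b = 2"
      using row_insert_Some_mem row_insert_Some(3) r1 Some Cons.prems by fastforce
    obtain s1 out1 where s1: "row_insert 2 s = (s1, out1)" by fastforce
    obtain rs1 where "insert_rows z ((r, s), rs) = ((r1, s1), rs1)"
      using r1 Some b s1 by (cases out1) auto
    then have IH: "big s' \<le> big s1" "set r' \<subseteq> {1, 2}"
      using Cons.IH[of r1 s1 rs1] Cons.prems r1set by auto
    have "big s1 \<le> big s \<and> (big s > 0 \<longrightarrow> big s1 < big s)"
    proof (cases out1)
      case None
      then have "big s = 0" using row_insert_None s1 by (simp add: big_eq_0_iff)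
      then show ?thesis using big_row_insert_None s1 None by simp
    next
      case (Some c)
      then show ?thesis using big_row_insert_Some[of 2 s s1 c] row_insert_Some(3)[of 2 s s1 c] s1 by simp
    qed
    then show ?thesis using IH by auto
  qed
qed auto

lemma sorted_mset_eq:
  assumes "mset x = mset y" "sorted x" "sorted (y :: nat list)" shows "x = y"
  using assms by (metis properties_for_sort)

text \<open>Counting letters above 2 shows that right multiplication by \<open>v\<close> bumps
  nothing. So left multiplication must lengthen only the first row, and this is traced through its
  first step, the column insertion of a 2.\<close>

lemma commute_two:
  assumes v: "set v \<subseteq> {1, 2}" "2 \<in> set v" and w: "w \<in> positive_words" "commute v w"
    and t: "rows w = ((r, s), rs)" and r: "set r \<subseteq> {1, 2}" and s: "big s > 0"
  shows "commute [2] w \<and> set v \<subseteq> {2}"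
proof -
  have val: "sorted r" "sorted s" "column_strict r s" "\<forall>c\<in>set r. 1 \<le> c"
    using valid_rows[OF w(1)] t by auto
  obtain r' s' rs' where t': "rows (w @ v) = ((r', s'), rs')" by (metis prod.exhaust)
  have L: "foldr left_insert v ((r, s), rs) = ((r', s'), rs')"
    using rows_append_left[OF v(1) w(1)] w(2) t t' by simp
  have R: "fold insert_rows v ((r, s), rs) = ((r', s'), rs')" using rows_append[of w v] t t' by simp
  note nb = fold_insert_rows_no_bump[OF v(1) r R]
  have "mset r' + mset s' = mset v + mset r + mset s" using foldr_left_insert_mono[OF L] by blast
  then have "big (r' @ s') = big (v @ r @ s)" by (simp add: big_def)
  moreover have "big r = 0" "big v = 0" "big r' = 0" using r v nb by (auto simp: big_eq_0_iff)
  ultimately have "big s' = big s" by (simp add: big_append)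
  then have res: "r' = r @ v" "s' = s" using nb s by auto
  have "w @ v \<in> positive_words" using v w by (auto simp: words_def)
  then have sv: "sorted (r @ v)" using valid_rows[of "w @ v"] t' res by simp
  obtain v' x where vx: "v = v' @ [x]" using v(2) by (cases v rule: rev_cases) auto
  \<comment> \<open>Left multiplication starts with the last letter of \<open>v\<close>, which is 2
    because \<open>r @ v\<close> is sorted and \<open>v\<close> contains a 2.\<close>
  then have "x = 2" using v sv by (auto simp: sorted_append)
  obtain r1 s1 where c: "column_insert2 2 r s = (r1, s1)" by fastforce
  have L1: "rows (2 # w) = ((r1, s1), rs)" using rows_Cons[of 2 w] w(1) t c by simp
  then have val1: "sorted r1" "sorted s1" "column_strict r1 s1" "\<forall>c\<in>set r1. 1 \<le> c"
    using valid_rows[of "2 # w"] w(1) by (auto simp: words_def)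
  have L2: "foldr left_insert v' ((r1, s1), rs) = ((r', s'), rs')"
    using L vx \<open>x = 2\<close> c by simp
  \<comment> \<open>The length of the second row never decreases and ends at
    \<open>length s\<close>, so the first row gains exactly one letter \<open>y\<close>
    here.\<close>
  have len: "length s1 = length s" and sub: "mset r \<subseteq># mset r1" "mset r1 \<subseteq># mset r'"
    using column_insert2_mono[OF c] foldr_left_insert_mono[OF L2] res by auto
  have tot: "mset r1 + mset s1 = add_mset 2 (mset r + mset s)" by (rule mset_column_insert2[OF c])
  have "size (mset r1 - mset r) = 1"
    using arg_cong[OF tot, of size] len size_Diff_submset[OF sub(1)] by simp
  then obtain y where "mset r1 - mset r = {#y#}" using size_1_singleton_mset by blast
  then have y: "mset r1 = add_mset y (mset r)" using sub(1) by (metis add_mset_add_single subset_mset.diff_add union_commute)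
  have "add_mset y (mset s1) = add_mset 2 (mset s)" using tot y by (simp add: add_mset_commute)
  then have ys: "y = 2 \<or> y \<in> set s" by (metis insert_iff set_mset_add_mset_insert set_mset_mset union_single_eq_member)
  have "y \<in> set r'" using sub(2) y by (metis mset_subset_eqD set_mset_mset union_single_eq_member)
  then have "y \<le> 2" using nb by auto
  moreover have "2 \<le> y" using ys column_strict_ge2[OF val(3,4)] by auto
  ultimately have y2: "y = 2" by simp
  have r1: "r1 = r @ [2]"
    using y y2 val val1 r by (intro sorted_mset_eq) (auto simp: sorted_append)
  have "s1 = s" using tot y y2 val val1 by (intro sorted_mset_eq) auto
  moreover have "row_insert 2 r = (r @ [2], None)" using r by (intro row_insert_append) auto
  ultimately have "rows ([2] @ w) = rows (w @ [2])"
    using L1 r1 t rows_append[of w "[2]"] by simp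
  \<comment> \<open>A 1 in \<open>v\<close> would leave only ones in \<open>r\<close>, as
    \<open>r @ v\<close> is sorted; the appended letter would then be the last of
    \<open>2 # s\<close>, which is above 2.\<close>
  moreover have "1 \<notin> set v"
  proof
    assume "1 \<in> set v"
    then have "\<forall>c\<in>set r. c < 2" using sv by (fastforce simp: sorted_append)
    moreover have "sorted (2 # s)" using val column_strict_ge2 by auto
    ultimately have "last (2 # s) = 2" using fst_column_insert2[of r 2 s] val c r1 by auto
    moreover have "\<forall>c\<in>set s. c \<le> last (2 # s)"
      using val by (cases s rule: rev_cases) (auto simp: sorted_append)
    ultimately show False using s by (auto simp: big_eq_0_iff[symmetric])
  qed
  ultimately show ?thesis using v by auto
qed

section \<open>Shape of the remaining tableaux and conclusion\<close>

lemma sorted_12: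
  assumes "sorted r" "set r \<subseteq> {1, 2 :: nat}"
  shows "\<exists>p q. r = replicate p 1 @ replicate q 2"
  using assms
proof (induction r)
  case (Cons x r)
  then obtain p q where r: "r = replicate p 1 @ replicate q 2" by auto
  show ?case
  proof (cases "x = 1")
    case True
    then have "x # r = replicate (Suc p) 1 @ replicate q 2" using r by simp
    then show ?thesis by blast
  next
    case False
    then have "x = 2" "p = 0" using Cons.prems r by (cases p; auto)+
    then have "x # r = replicate 0 1 @ replicate (Suc q) 2" using r by simp
    then show ?thesis by blast
  qed
qed simp

lemma column_strict_replicate:
  "column_strict (replicate p 1 @ replicate q 2) (replicate e 2) \<Longrightarrow> e \<le> p"
proof (induction e arbitrary: p)
  case (Suc e)
  then show ?case by (cases p; cases q) auto
qed simp

lemma commute_of_word_power: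
  assumes u: "set u \<subseteq> {1, 2}" and w: "w \<in> positive_words" "commute (word_power u (Suc k)) w"
  shows "commute u w"
proof (cases "2 \<in> set u")
  case False
  show ?thesis
  proof (cases u)
    case (Cons x u')
    then have "set (word_power u (Suc k)) = {1}"
      using False u set_word_power[of u k] by auto
    then have "commute [1] w" using commute_ones w by blast
    then show ?thesis using commute_constant[of u 1 w] False u w by auto
  qed simp
next
  case True
  let ?v = "word_power u (Suc k)"
  have v: "set ?v \<subseteq> {1, 2}" "2 \<in> set ?v" "set u \<subseteq> set ?v" using True u set_word_power[of u k] by auto
  obtain r s rs where t: "rows w = ((r, s), rs)" by (metis prod.exhaust)
  have val: "sorted r" "sorted s" "column_strict r s" "\<forall>c\<in>set r. 1 \<le> c"
    using valid_rows[OF w(1)] t by auto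
  obtain r' s' rs' where t': "rows (w @ ?v) = ((r', s'), rs')" by (metis prod.exhaust)
  have L: "foldr left_insert ?v ((r, s), rs) = ((r', s'), rs')"
    using rows_append_left[OF v(1) w(1)] w(2) t t' by simp
  \<comment> \<open>Left multiplication keeps all letters of the first row, whereas right
    multiplication by a word with a 2 loses one above 2 if any is present.\<close>
  have "big r \<le> big r'"
    using foldr_left_insert_mono[OF L] unfolding big_def
    by (intro size_mset_mono multiset_filter_mono) auto
  moreover have "big r' < big r" if "big r > 0"
  proof -
    have "\<forall>z\<in>set ?v. z \<le> 2" using v(1) by fastforce
    then have "big (fst (fst (fold insert_rows ?v (rows w)))) < big (fst (fst (rows w)))"
      by (intro big_fold_insert_rows_less) (use v(2) that t in simp_all)
    then have "big (fst (fst (rows (w @ ?v)))) < big (fst (fst (rows w)))"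
      by (simp only: rows_append)
    then show ?thesis by (simp only: t t' fst_conv)
  qed
  ultimately have "big r = 0" by linarith
  then have "\<forall>c\<in>set r. c = 1 \<or> c = 2" using val(4) unfolding big_eq_0_iff by force
  then have r: "set r \<subseteq> {1, 2}" by auto
  show ?thesis
  proof (cases "big s = 0")
    case False
    then have "commute [2] w" "set u \<subseteq> {2}"
      using commute_two[OF v(1,2) w t r] v(3) by auto
    then show ?thesis using commute_constant w by blast
  next
    case True
    then have "\<forall>c\<in>set s. c = 2"
      using column_strict_ge2[OF val(3,4)] unfolding big_eq_0_iff by force
    then have "s = replicate (length s) 2" by (metis replicate_eqI)
    moreover obtain p q where pq: "r = replicate p 1 @ replicate q 2" using sorted_12 val(1) r by blast
    \<comment> \<open>Column strictness puts every 2 of the second row under a 1, so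
      \<open>p - length s\<close> is not truncated.\<close>
    ultimately have "rows w = conf (p - length s) q (length s) rs"
      using t val(3) column_strict_replicate[of p q "length s"] by (simp add: conf_def)
    then show ?thesis using commute_of_word_power_rank2 u w by blast
  qed
qed

theorem theorem2p13:
  fixes n :: nat and u :: "nat list"
  assumes "u \<in> words_of_length 2 n"
  shows "strongly_stable u"
  unfolding strongly_stable_def
proof (intro allI impI)
  fix k :: nat assume "1 \<le> k"
  then obtain j where k: "k = Suc j" by (cases k) auto
  have u: "set u \<subseteq> {1, 2}" using assms by (auto simp: words_of_length_def words_def)
  show "centralizer (word_power u k) = centralizer u"
    unfolding centralizer_def insertion_tableau_eq_iff k
    using commute_of_word_power[OF u, of _ j] commute_word_power[OF u, of _ "Suc j"] by blast
qed

end
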